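(* Let $n\ge 3$, let $x_{k-1},y_{k-1}\in\mathbb{R}^n$ be points, $g\in\mathbb{R}^n$ a nonzero vector, and $\rho,\sigma,\delta,\ell$ positive scalars. Let $\bar{\bar x}_{k-1}=x_{k-1}-g/\ell$ and $$\lambda^*=\frac{\delta^2+\rho^2-\sigma^2}{2\delta^2}.$$ Assume: - $\delta=\|\bar{\bar x}_{k-1}-y_{k-1}\|$, - $\rho<\|g\|/\ell$, - $\rho+\sigma\ge\delta$, - $\delta\ge\sqrt{|\rho^2-\sigma^2|}$, - $(y_{k-1}-\bar{\bar x}_{k-1})^Tg>\rho^2\ell/\lambda^*$. Let $\mathcal{F}$ be the set of functions $f:\mathbb{R}^n\to\mathbb{R}$ such that - $f$ is strongly convex with modulus $\ell$, - $\nabla f(x_{k-1})=g$, - $\dfrac{\|g\|^2}{\ell^2}-\dfrac{2(f(x_{k-1})-\min\{f\})}{\ell}=\rho^2$, - $\mathrm{argmin}\{f\}\in B(y_{k-1},\sigma)$. Let $\mathcal{M}_k=\mathrm{aff}\{x_{k-1},y_{k-1},\bar{\bar x}_{k-1}\}$ and define $$q(y)=\sup\{\|y-\mathrm{argmin}\{f\}\|:f\in\mathcal{F}\}.$$ Let $y_k=(1-\lambda^* )\bar{\bar x}_{k-1}+\lambda^*y_{k-1}$ be the point computed by the Geometric Descent algorithm for this data. Then $$y_k=\mathrm{argmin}\{q(y):y\in\mathcal{M}_k\}.$$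
   Context: $\min\{f\}$ and $\mathrm{argmin}\{f\}$ are shorthand for $\min\{f(x):x\in\mathbb{R}^n\}$ and the (unique) minimizer of $f$ over $\mathbb{R}^n$. $B(x,r)=\{y\in\mathbb{R}^n:\|x-y\|\le r\}$ is the closed ball, and $\mathrm{aff}$ denotes affine hull. "$f$ is strongly convex with modulus $\ell$" means that $f-\frac{\ell}{2}\|\cdot\|^2$ is convex ($f$ need not be differentiable everywhere); "$\nabla f(x_{k-1})=g$" means that $f$ is differentiable at $x_{k-1}$ with gradient $g$. The hypothesis involving $\rho^2\ell/\lambda^*$ presupposes $\lambda^*\ne 0$. The conclusion means that $y_k$ is the unique minimizer of $q$ over $\mathcal{M}_k$. The index $k$ only labels the given data. *)

theory Defs
  imports "HOL-Analysis.Analysis"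
begin

definition strongly_convex :: "real \<Rightarrow> ('a::real_inner \<Rightarrow> real) \<Rightarrow> bool"
  where "strongly_convex l f \<longleftrightarrow> convex_on UNIV (\<lambda>x. f x - l / 2 * (norm x)\<^sup>2)"

(* On a finite-dimensional space, a strongly convex f :: 'a => real with l > 0 attains its
   minimum at exactly one point, so arg_min_on f UNIV is argmin{f} and
   f (arg_min_on f UNIV) is min{f}. *)
definition admissible_functions ::
  "'a::euclidean_space \<Rightarrow> 'a \<Rightarrow> 'a \<Rightarrow> real \<Rightarrow> real \<Rightarrow> real \<Rightarrow> ('a \<Rightarrow> real) set"
  where "admissible_functions x y g \<rho> \<sigma> l =
    {f. strongly_convex l f \<and>
        GDERIV f x :> g \<and>
        (norm g)\<^sup>2 / l\<^sup>2 - 2 * (f x - f (arg_min_on f UNIV)) / l = \<rho>\<^sup>2 \<and>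
        arg_min_on f UNIV \<in> cball y \<sigma>}"

(* The supremum is taken in ereal, so that it is the true supremum even for an empty or
   unbounded set of values. *)
definition worst_case_dist :: "('a::real_normed_vector \<Rightarrow> real) set \<Rightarrow> 'a \<Rightarrow> ereal"
  where "worst_case_dist F z = (SUP f\<in>F. ereal (norm (z - arg_min_on f UNIV)))"

end

theory Submission
  imports Defs
begin

text \<open>
  Put \<open>c = x - g / l\<close>. The gradient inequality of strong convexity at \<open>x\<close> confines the minimizer
  of every admissible function to the ball of radius \<open>\<rho>\<close> around \<open>c\<close>. Conversely, every \<open>m\<close> with
  \<open>\<parallel>m - c\<parallel> = \<rho>\<close>, \<open>\<parallel>m - y\<parallel> \<le> \<sigma>\<close> and \<open>(m - c) \<bullet> g > \<rho>\<^sup>2 l\<close> is the minimizer of an admissible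
  function, namely of the maximum of two quadratics with Hessian \<open>l I\<close> centred at \<open>c\<close> and at \<open>m\<close>.
  The two spheres around \<open>c\<close> and \<open>y\<close> meet in a sphere of some radius \<open>r\<close> around
  \<open>y\<^sub>k = c + \<lambda> (y - c)\<close>, inside the hyperplane through \<open>y\<^sub>k\<close> orthogonal to \<open>y - c\<close>, and the
  intersection of the two balls lies within distance \<open>r\<close> of \<open>y\<^sub>k\<close>. As the dimension is at least 3,
  there is a unit vector \<open>w\<close> orthogonal to \<open>M\<close>. The point \<open>m = y\<^sub>k + r w\<close> is an attainable
  minimizer, and it has distance at least \<open>sqrt (\<parallel>z - y\<^sub>k\<parallel>\<^sup>2 + r\<^sup>2)\<close> from every \<open>z \<in> M\<close>.
\<close>

text \<open>On the line from \<open>x\<close> to \<open>z\<close>, \<open>f\<close> minus its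
  quadratic part is a convex function \<open>h\<close> of one real variable; its tangent at 0 gives
  the bound at 1. Only differentiability at \<open>x\<close> enters.\<close>

lemma strongly_convex_above_tangent:
  assumes sc: "strongly_convex l f" and grad: "GDERIV f x :> g"
  shows "f z \<ge> f x + g \<bullet> (z - x) + l / 2 * (norm (z - x))\<^sup>2"
proof -
  define h where "h = (\<lambda>t. f (x + t *\<^sub>R (z - x)) - l / 2 * (norm (x + t *\<^sub>R (z - x)))\<^sup>2)"
  have "convex_on UNIV h"
  proof (rule convex_onI)
    fix t a b :: real
    assume "0 < t" "t < 1"
    have "x + ((1 - t) * a + t * b) *\<^sub>R (z - x)
        = (1 - t) *\<^sub>R (x + a *\<^sub>R (z - x)) + t *\<^sub>R (x + b *\<^sub>R (z - x))"
      by (simp add: algebra_simps)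
    then show "h ((1 - t) *\<^sub>R a + t *\<^sub>R b) \<le> (1 - t) * h a + t * h b"
      using convex_onD[OF sc[unfolded strongly_convex_def], of t
          "x + a *\<^sub>R (z - x)" "x + b *\<^sub>R (z - x)"] \<open>0 < t\<close> \<open>t < 1\<close>
      by (simp add: h_def)
  qed simp
  moreover have "(h has_field_derivative g \<bullet> (z - x) - l * (x \<bullet> (z - x))) (at 0)"
  proof -
    have "((\<lambda>t. f (x + t *\<^sub>R (z - x))) has_derivative (\<lambda>t. (t *\<^sub>R (z - x)) \<bullet> g)) (at 0)"
      by (rule has_derivative_compose[where f = "\<lambda>t. x + t *\<^sub>R (z - x)"])
        (use grad in \<open>auto simp: gderiv_def intro!: derivative_eq_intros\<close>)
    then have "((\<lambda>t. f (x + t *\<^sub>R (z - x))) has_field_derivative g \<bullet> (z - x)) (at 0)"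
      by (simp add: has_field_derivative_def inner_commute mult_commute_abs)
    moreover have "((\<lambda>t. l / 2 * (norm (x + t *\<^sub>R (z - x)))\<^sup>2)
        has_field_derivative l * (x \<bullet> (z - x))) (at 0)"
      unfolding power2_norm_eq_inner inner_add_left inner_add_right inner_scaleR_left
        inner_scaleR_right
      by (auto intro!: derivative_eq_intros simp: inner_commute)
    ultimately show ?thesis
      unfolding h_def by (rule DERIV_diff)
  qed
  ultimately have "h 1 - h 0 \<ge> (g \<bullet> (z - x) - l * (x \<bullet> (z - x))) * (1 - 0)"
    by (intro convex_on_imp_above_tangent[where A = UNIV]) auto
  then show ?thesis
    by (simp add: h_def power2_norm_eq_inner inner_diff_left inner_diff_right inner_commute
        algebra_simps)
qed

text \<open>Subtracting the same quadratic commutes with \<open>max\<close>, which reduces the claim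
  to plain convexity.\<close>

lemma strongly_convex_max:
  assumes "strongly_convex l f" "strongly_convex l h"
  shows "strongly_convex l (\<lambda>z. max (f z) (h z))"
proof -
  have "max (f z) (h z) - l / 2 * (norm z)\<^sup>2
      = max (f z - l / 2 * (norm z)\<^sup>2) (h z - l / 2 * (norm z)\<^sup>2)" for z
    by simp
  moreover have "convex_on UNIV (\<lambda>z. max (F z) (H z))"
    if F: "convex_on UNIV F" and H: "convex_on UNIV H" for F H :: "'a \<Rightarrow> real"
  proof (rule convex_onI)
    fix t :: real and a b :: 'a
    assume t: "0 < t" "t < 1"
    have "(1 - t) * F a + t * F b \<le> (1 - t) * max (F a) (H a) + t * max (F b) (H b)"
      "(1 - t) * H a + t * H b \<le> (1 - t) * max (F a) (H a) + t * max (F b) (H b)"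
      using t by (auto intro!: add_mono mult_left_mono)
    then show "max (F ((1 - t) *\<^sub>R a + t *\<^sub>R b)) (H ((1 - t) *\<^sub>R a + t *\<^sub>R b))
        \<le> (1 - t) * max (F a) (H a) + t * max (F b) (H b)"
      using convex_onD[OF F, of t a b] convex_onD[OF H, of t a b] t by simp
  qed simp
  ultimately show ?thesis
    using assms by (simp add: strongly_convex_def)
qed

text \<open>The square terms cancel, and an affine function of \<open>z\<close> remains.\<close>

lemma strongly_convex_quadratic:
  "strongly_convex l (\<lambda>z. l / 2 * (norm (z - p))\<^sup>2 + k)"
proof -
  have "l / 2 * (norm (z - p))\<^sup>2 + k - l / 2 * (norm z)\<^sup>2 = l / 2 * (p \<bullet> p) + k - l * (z \<bullet> p)" for z
    by (simp add: power2_norm_eq_inner inner_diff_left inner_diff_right inner_commute algebra_simps)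
  moreover have "convex_on UNIV (\<lambda>z. k' - l * (z \<bullet> p))" for k'
    by (rule convex_onI) (simp_all add: inner_add_left algebra_simps)
  ultimately show ?thesis
    unfolding strongly_convex_def by (simp only:)
qed

text \<open>\<open>arg_min_on\<close> is a choice among minimizers; strictness leaves only one
  candidate.\<close>

lemma arg_min_on_unique:
  fixes f :: "'a \<Rightarrow> real"
  assumes "m \<in> S" and "\<And>z. z \<in> S \<Longrightarrow> z \<noteq> m \<Longrightarrow> f m < f z"
  shows "arg_min_on f S = m"
proof -
  have "is_arg_min f (\<lambda>z. z \<in> S) z \<longleftrightarrow> z = m" for z
    unfolding is_arg_min_def using assms by (metis less_asym less_irrefl)
  then show ?thesis
    by (simp add: arg_min_on_def arg_min_def)
qed

text \<open>Take the tangent bound at \<open>m\<close>, scale it by \<open>2 / l\<close> and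
  complete the square: the terms in \<open>m - x\<close> become the squared distance from
  \<open>m\<close> to the ball's centre, minus \<open>(norm g)\<^sup>2 / l\<^sup>2\<close>.\<close>

lemma admissible_minimizer_in_ball:
  assumes "0 < l" "0 < \<rho>" and f: "f \<in> admissible_functions x y g \<rho> \<sigma> l"
  shows "arg_min_on f UNIV \<in> cball (x - (1 / l) *\<^sub>R g) \<rho> \<inter> cball y \<sigma>"
proof -
  define m where "m = arg_min_on f UNIV"
  have tangent: "f m \<ge> f x + g \<bullet> (m - x) + l / 2 * (norm (m - x))\<^sup>2"
    and val: "(norm g)\<^sup>2 / l\<^sup>2 - 2 * (f x - f m) / l = \<rho>\<^sup>2"
    and my: "m \<in> cball y \<sigma>"
    using f strongly_convex_above_tangent[of l f x g m]
    by (auto simp: admissible_functions_def m_def)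
  have "(norm (m - x))\<^sup>2 + 2 / l * (g \<bullet> (m - x))
      = 2 * (g \<bullet> (m - x) + l / 2 * (norm (m - x))\<^sup>2) / l"
    using \<open>0 < l\<close> by (simp add: field_simps)
  also have "\<dots> \<le> 2 * (f m - f x) / l"
    using tangent \<open>0 < l\<close> by (intro divide_right_mono) auto
  finally have "(norm (m - x))\<^sup>2 + 2 / l * (g \<bullet> (m - x)) \<le> 2 * (f m - f x) / l" .
  moreover have "m - (x - (1 / l) *\<^sub>R g) = (m - x) + (1 / l) *\<^sub>R g"
    by simp
  then have "(norm (m - (x - (1 / l) *\<^sub>R g)))\<^sup>2
      = (norm (m - x))\<^sup>2 + 2 / l * (g \<bullet> (m - x)) + (norm g)\<^sup>2 / l\<^sup>2"
    by (simp only: power2_norm_eq_inner inner_add_left inner_add_right inner_scaleR_left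
        inner_scaleR_right) (simp add: inner_commute power2_eq_square add_divide_distrib)
  ultimately have "(norm (m - (x - (1 / l) *\<^sub>R g)))\<^sup>2 \<le> \<rho>\<^sup>2"
    using val by (simp add: diff_divide_distrib right_diff_distrib)
  then have "norm (m - (x - (1 / l) *\<^sub>R g)) \<le> \<rho>"
    by (rule power2_le_imp_le) (use \<open>0 < \<rho>\<close> in simp)
  then show ?thesis
    using my by (simp add: m_def dist_norm norm_minus_commute)
qed

text \<open>The bound on \<open>(m - c) \<bullet> g\<close> makes the quadratic centred at
  \<open>c\<close> strictly dominate at \<open>x\<close>, hence near \<open>x\<close>, where its
  gradient is \<open>l *\<^sub>R (x - c) = g\<close>. The quadratic centred at \<open>m\<close>
  forces the minimizer.\<close>

lemma admissible_with_minimizer: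
  assumes "0 < l" and c: "c = x - (1 / l) *\<^sub>R g"
    and m\<rho>: "norm (m - c) = \<rho>" and m\<sigma>: "norm (m - y) \<le> \<sigma>" and mg: "(m - c) \<bullet> g > \<rho>\<^sup>2 * l"
  obtains f where "f \<in> admissible_functions x y g \<rho> \<sigma> l" "arg_min_on f UNIV = m"
proof
  \<comment> \<open>The constant in \<open>?p\<close> is the value of \<open>?q\<close> at
    \<open>m\<close>, so both quadratics agree there and \<open>f m\<close> yields the prescribed
    gap. The \<open>+ 0\<close> fits \<open>?q\<close> to the shape of
    \<open>strongly_convex_quadratic\<close>.\<close>
  let ?q = "\<lambda>z. l / 2 * (norm (z - c))\<^sup>2 + 0"
    and ?p = "\<lambda>z. l / 2 * (norm (z - m))\<^sup>2 + l / 2 * \<rho>\<^sup>2"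
  define f where "f = (\<lambda>z. max (?q z) (?p z))"
  have xc: "x - c = (1 / l) *\<^sub>R g"
    by (simp add: c)
  have fm: "f m = l / 2 * \<rho>\<^sup>2"
    using \<open>0 < l\<close> by (simp add: f_def m\<rho>)
  show argmin: "arg_min_on f UNIV = m"
  proof (rule arg_min_on_unique)
    fix z assume "z \<noteq> m"
    then have "f m < ?p z"
      using \<open>0 < l\<close> by (simp add: fm)
    also have "\<dots> \<le> f z"
      unfolding f_def by (rule max.cobounded2)
    finally show "f m < f z" .
  qed simp
  have "x - m = (x - c) - (m - c)"
    by simp
  then have "(norm (x - m))\<^sup>2 = (norm (x - c))\<^sup>2 - 2 / l * ((m - c) \<bullet> g) + \<rho>\<^sup>2"
    by (simp only: power2_norm_eq_inner inner_diff_left[of "x - c"] inner_diff_right[of _ "x - c"]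
        m\<rho>[symmetric]) (simp add: xc inner_commute algebra_simps)
  moreover have "2 / l * ((m - c) \<bullet> g) > 2 * \<rho>\<^sup>2"
    using mg \<open>0 < l\<close> by (simp add: field_simps)
  ultimately have "(norm (x - m))\<^sup>2 + \<rho>\<^sup>2 < (norm (x - c))\<^sup>2"
    by simp
  then have qp: "?p x < ?q x"
    using \<open>0 < l\<close> by (simp add: distrib_left[symmetric])
  have sc: "strongly_convex l f"
    unfolding f_def by (intro strongly_convex_max strongly_convex_quadratic)
  have "GDERIV f x :> g"
    unfolding gderiv_def
  proof (rule has_derivative_transform_within_open)
    show "open {z. ?p z < ?q z}"
      by (intro open_Collect_less continuous_intros)
    have "((\<lambda>z. l / 2 * ((z - c) \<bullet> (z - c))) has_derivative (\<lambda>h. h \<bullet> g)) (at x)"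
      by (rule derivative_eq_intros refl | simp)+
        (use \<open>0 < l\<close> in \<open>simp add: xc inner_commute\<close>)
    then show "(?q has_derivative (\<lambda>h. h \<bullet> g)) (at x)"
      by (simp add: power2_norm_eq_inner)
  qed (use qp in \<open>auto simp: f_def\<close>)
  moreover have "f x = (norm g)\<^sup>2 / (2 * l)"
    using qp \<open>0 < l\<close> by (simp add: f_def xc power_divide power2_eq_square)
  then have "(norm g)\<^sup>2 / l\<^sup>2 - 2 * (f x - f m) / l = \<rho>\<^sup>2"
    using \<open>0 < l\<close> by (simp add: fm field_simps power2_eq_square)
  ultimately show "f \<in> admissible_functions x y g \<rho> \<sigma> l"
    using sc m\<sigma> by (simp add: admissible_functions_def argmin dist_norm norm_minus_commute)
qed

text \<open>Stewart's theorem; with \<open>t = lam\<close> it turns bounds on the distances to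
  \<open>xbb\<close> and \<open>y\<close> into one on the distance to \<open>yk\<close>.\<close>

lemma norm_convex_combination:
  fixes a b :: "'a::real_inner"
  shows "(norm ((1 - t) *\<^sub>R a + t *\<^sub>R b))\<^sup>2
    = (1 - t) * (norm a)\<^sup>2 + t * (norm b)\<^sup>2 - t * (1 - t) * (norm (a - b))\<^sup>2"
  unfolding power2_norm_eq_inner
  by (simp add: inner_add_left inner_add_right inner_diff_left inner_diff_right inner_commute
      algebra_simps power2_eq_square)

theorem theorem5:
  fixes x y g xbb yk :: "real ^ 'n"
    and \<rho> \<sigma> \<delta> l lam :: real
    and F :: "(real ^ 'n \<Rightarrow> real) set"
    and M :: "(real ^ 'n) set"
  assumes "CARD('n) \<ge> 3"
    and "g \<noteq> 0"
    and "\<rho> > 0" and "\<sigma> > 0" and "\<delta> > 0" and "l > 0"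
    and xbb_eq: "xbb = x - (1 / l) *\<^sub>R g"
    and lam_eq: "lam = (\<delta>\<^sup>2 + \<rho>\<^sup>2 - \<sigma>\<^sup>2) / (2 * \<delta>\<^sup>2)"
    and "\<delta> = norm (xbb - y)"
    and "\<rho> < norm g / l"
    and "\<rho> + \<sigma> \<ge> \<delta>"
    and "\<delta> \<ge> sqrt \<bar>\<rho>\<^sup>2 - \<sigma>\<^sup>2\<bar>"
    and "lam \<noteq> 0"
    and "(y - xbb) \<bullet> g > \<rho>\<^sup>2 * l / lam"
    and F_eq: "F = admissible_functions x y g \<rho> \<sigma> l"
    and M_eq: "M = affine hull {x, y, xbb}"
    and yk_eq: "yk = (1 - lam) *\<^sub>R xbb + lam *\<^sub>R y"
  shows "\<forall>z. is_arg_min (worst_case_dist F) (\<lambda>z. z \<in> M) z \<longleftrightarrow> z = yk"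
proof -
  define u where "u = y - xbb"
  \<comment> \<open>The square of the radius r: the centre \<open>xbb\<close> lies at distance
    \<open>lam * \<delta>\<close> from the hyperplane.\<close>
  define R where "R = \<rho>\<^sup>2 - lam\<^sup>2 * \<delta>\<^sup>2"
  note \<delta> = \<open>\<delta> = norm (xbb - y)\<close>
  have \<delta>u: "norm u = \<delta>"
    by (simp add: \<delta> u_def norm_minus_commute)
  have yk: "yk = xbb + lam *\<^sub>R u"
    by (simp add: yk_eq u_def algebra_simps)
  have lam\<delta>: "2 * (lam * \<delta>\<^sup>2) = \<delta>\<^sup>2 + \<rho>\<^sup>2 - \<sigma>\<^sup>2"
    using \<open>\<delta> > 0\<close> by (simp add: lam_eq)
  have diff_le: "\<bar>\<rho>\<^sup>2 - \<sigma>\<^sup>2\<bar> \<le> \<delta>\<^sup>2"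
    using \<open>\<delta> \<ge> sqrt \<bar>\<rho>\<^sup>2 - \<sigma>\<^sup>2\<bar>\<close> \<open>\<delta> > 0\<close> by (simp add: real_sqrt_le_iff' real_le_lsqrt)
  \<comment> \<open>So \<open>yk\<close> lies on the segment from \<open>xbb\<close> to
    \<open>y\<close>, and the weights \<open>1 - lam\<close> and \<open>lam\<close> are
    nonnegative.\<close>
  have lam: "0 < lam" "lam \<le> 1"
    using diff_le \<open>lam \<noteq> 0\<close> \<open>\<delta> > 0\<close> by (auto simp: lam_eq field_simps abs_le_iff less_le)
  \<comment> \<open>The right-hand side of \<open>norm_convex_combination\<close> with extremal
    distances \<rho> and \<sigma>.\<close>
  have R_eq: "R = (1 - lam) * \<rho>\<^sup>2 + lam * \<sigma>\<^sup>2 - lam * (1 - lam) * \<delta>\<^sup>2"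
    using lam\<delta> unfolding R_def by algebra
  \<comment> \<open>First \<rho>, \<sigma>, \<delta> are shown to satisfy the triangle inequalities.
    The product below is then Heron's formula for 16 times the squared area of that triangle, and
    \<open>R\<close> is its squared height over the side \<delta>.\<close>
  have "R \<ge> 0"
  proof -
    have "\<bar>\<rho> - \<sigma>\<bar> * (\<rho> + \<sigma>) = \<bar>\<rho>\<^sup>2 - \<sigma>\<^sup>2\<bar>"
      using \<open>\<rho> > 0\<close> \<open>\<sigma> > 0\<close> by (simp add: power2_eq_square square_diff_square_factored abs_mult)
    moreover have "\<bar>\<rho> - \<sigma>\<bar> * \<delta> \<le> \<bar>\<rho> - \<sigma>\<bar> * (\<rho> + \<sigma>)"
      using \<open>\<rho> + \<sigma> \<ge> \<delta>\<close> by (intro mult_left_mono) auto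
    ultimately have "\<bar>\<rho> - \<sigma>\<bar> * \<delta> \<le> \<delta> * \<delta>"
      using diff_le by (simp add: power2_eq_square)
    then have "\<bar>\<rho> - \<sigma>\<bar> \<le> \<delta>"
      using \<open>\<delta> > 0\<close> by simp
    then have "0 \<le> (\<sigma>\<^sup>2 - (\<rho> - \<delta>)\<^sup>2) * ((\<rho> + \<delta>)\<^sup>2 - \<sigma>\<^sup>2)"
      using \<open>\<rho> + \<sigma> \<ge> \<delta>\<close> \<open>\<rho> > 0\<close> \<open>\<delta> > 0\<close> \<open>\<sigma> > 0\<close>
      by (intro mult_nonneg_nonneg) (auto simp: abs_le_square_iff[symmetric])
    also have "\<dots> = (2 * \<delta>)\<^sup>2 * R"
      using lam\<delta> unfolding R_def by algebra
    finally show ?thesis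
      using \<open>\<delta> > 0\<close> by (simp add: zero_le_mult_iff)
  qed
  have upper: "worst_case_dist F yk \<le> ereal (sqrt R)"
    unfolding worst_case_dist_def
  proof (rule SUP_least)
    fix f assume "f \<in> F"
    define m where "m = arg_min_on f UNIV"
    have "norm (m - xbb) \<le> \<rho>" "norm (m - y) \<le> \<sigma>"
      using admissible_minimizer_in_ball \<open>f \<in> F\<close> \<open>l > 0\<close> \<open>\<rho> > 0\<close>
      by (fastforce simp: F_eq xbb_eq m_def dist_norm norm_minus_commute)+
    then have "(norm (m - xbb))\<^sup>2 \<le> \<rho>\<^sup>2" "(norm (m - y))\<^sup>2 \<le> \<sigma>\<^sup>2"
      by (simp_all add: power_mono)
    then have "(1 - lam) * (norm (m - xbb))\<^sup>2 + lam * (norm (m - y))\<^sup>2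
        - lam * (1 - lam) * (norm u)\<^sup>2 \<le> R"
      unfolding R_eq \<delta>u using lam by (intro diff_right_mono add_mono mult_left_mono) auto
    moreover have "m - yk = (1 - lam) *\<^sub>R (m - xbb) + lam *\<^sub>R (m - y)"
      by (simp add: yk_eq algebra_simps)
    moreover have "(m - xbb) - (m - y) = u"
      by (simp add: u_def)
    ultimately have "(norm (m - yk))\<^sup>2 \<le> R"
      by (simp only: norm_convex_combination)
    then show "ereal (norm (yk - arg_min_on f UNIV)) \<le> ereal (sqrt R)"
      by (simp add: m_def norm_minus_commute real_le_rsqrt)
  qed
  \<comment> \<open>The directions of \<open>M\<close> are spanned by \<open>g\<close> and
    \<open>u\<close>, because \<open>x - xbb\<close> is a multiple of \<open>g\<close> and
    \<open>y - xbb = u\<close>.\<close>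
  obtain w where w: "norm w = 1" "w \<bullet> g = 0" "w \<bullet> u = 0"
  proof -
    have "dim (span {g, u}) \<le> card {g, u}"
      by (simp add: dim_le_card')
    also have "\<dots> < DIM(real ^ 'n)"
      using \<open>CARD('n) \<ge> 3\<close> card_insert_le_m1[of 2 "{u}" g] by simp
    finally obtain w where "w \<noteq> 0" and w: "\<And>v. v \<in> span {g, u} \<Longrightarrow> orthogonal w v"
      using orthogonal_to_subspace_exists[of "{g, u}"] by auto
    show thesis
    proof
      show "norm (sgn w) = 1" "sgn w \<bullet> g = 0" "sgn w \<bullet> u = 0"
        using \<open>w \<noteq> 0\<close> w[of g] w[of u]
        by (auto simp: norm_sgn sgn_div_norm orthogonal_def span_base)
    qed
  qed
  have orth: "w \<bullet> (z - yk) = 0" if "z \<in> M" for z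
  proof -
    from that obtain a b d where "a + b + d = 1" "z = a *\<^sub>R x + b *\<^sub>R y + d *\<^sub>R xbb"
      by (auto simp: M_eq affine_hull_3)
    moreover have "x = xbb + (1 / l) *\<^sub>R g" "y = xbb + u"
      by (simp_all add: xbb_eq u_def)
    moreover have "d = 1 - a - b"
      using \<open>a + b + d = 1\<close> by simp
    ultimately have "z - yk = (a / l) *\<^sub>R g + (b - lam) *\<^sub>R u"
      by (simp add: yk algebra_simps)
    then show ?thesis
      by (simp add: inner_add_right w)
  qed
  \<comment> \<open>This choice does not depend on \<open>z\<close>, so one admissible function
    serves for all points of \<open>M\<close>.\<close>
  define m where "m = yk + sqrt R *\<^sub>R w"
  have mc: "m - xbb = lam *\<^sub>R u + sqrt R *\<^sub>R w" and my: "m - y = (lam - 1) *\<^sub>R u + sqrt R *\<^sub>R w"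
    by (simp_all add: m_def yk u_def algebra_simps)
  have pyth: "(norm (a *\<^sub>R u + sqrt R *\<^sub>R w))\<^sup>2 = a\<^sup>2 * \<delta>\<^sup>2 + R" for a
    using \<open>R \<ge> 0\<close> w by (subst norm_add_Pythagorean)
      (auto simp: orthogonal_def inner_commute power_mult_distrib \<delta>u)
  obtain f where f: "f \<in> F" "arg_min_on f UNIV = m"
  proof -
    have "(norm (m - xbb))\<^sup>2 = \<rho>\<^sup>2"
      unfolding mc pyth by (simp add: R_def)
    moreover have "(norm (m - y))\<^sup>2 = \<sigma>\<^sup>2"
      unfolding my pyth using lam\<delta> R_def by algebra
    ultimately have "norm (m - xbb) = \<rho>" "norm (m - y) \<le> \<sigma>"
      using \<open>\<rho> > 0\<close> \<open>\<sigma> > 0\<close> by (auto simp: power2_eq_iff_nonneg)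
    \<comment> \<open>As \<open>w\<close> is orthogonal to \<open>g\<close>, only the component
      along \<open>u\<close> counts, and the hypothesis on \<open>(y - xbb) \<bullet> g\<close>,
      multiplied by \<open>lam > 0\<close>, is the bound required.\<close>
    moreover have "(m - xbb) \<bullet> g = lam * (u \<bullet> g)"
      by (simp add: mc inner_add_left w)
    then have "(m - xbb) \<bullet> g > \<rho>\<^sup>2 * l"
      using \<open>(y - xbb) \<bullet> g > \<rho>\<^sup>2 * l / lam\<close> lam by (simp add: u_def field_simps)
    ultimately show thesis
      using admissible_with_minimizer[OF \<open>l > 0\<close> xbb_eq] that by (metis F_eq)
  qed
  have lower: "worst_case_dist F z > ereal (sqrt R)" if "z \<in> M" "z \<noteq> yk" for z
  proof -
    have "z - m = (z - yk) + - sqrt R *\<^sub>R w"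
      by (simp add: m_def)
    then have "(norm (z - m))\<^sup>2 = (norm (z - yk))\<^sup>2 + R"
      using orth[OF \<open>z \<in> M\<close>] w \<open>R \<ge> 0\<close>
      by (simp only:) (subst norm_add_Pythagorean,
        auto simp: orthogonal_def inner_commute power_mult_distrib)
    then have "sqrt R < norm (z - m)"
      using \<open>z \<noteq> yk\<close> by (intro real_less_lsqrt) auto
    also have "ereal (norm (z - m)) \<le> worst_case_dist F z"
      unfolding worst_case_dist_def f(2)[symmetric] by (rule SUP_upper) (rule f(1))
    finally show ?thesis
      by simp
  qed
  have "yk \<in> M"
    unfolding M_eq affine_hull_3 yk_eq
    by (intro CollectI exI[of _ 0] exI[of _ lam] exI[of _ "1 - lam"]) simp
  \<comment> \<open>The value at \<open>yk\<close> is at most \<open>sqrt R\<close>, and every other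
    value on \<open>M\<close> is strictly larger.\<close>
  then show ?thesis
    unfolding is_arg_min_def using upper lower by (metis leD le_less_trans less_imp_le)
qed

end
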